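(* Let $(V,E)$ be a finite electrical network with edge parameters $L_{xy},D_{xy},R_{xy}$, let $s\in\mathbb{C}$ with $\operatorname{Re} s>0$, and let $\widetilde\Delta_\rho$ be the associated normalized complex-weighted Laplacian. Let $\lambda\in\mathbb{C}$ be an eigenvalue of $\widetilde\Delta_\rho$. Then $$|1-\lambda|\le \frac{|s|}{\operatorname{Re} s}.$$
   Context: A finite electrical network consists of a finite nonempty vertex set $V$ and a set $E$ of undirected edges $xy$ without loops. Each edge $xy$ carries non-negative real numbers $L_{xy},D_{xy},R_{xy}$ (symmetric in $x,y$) with $L_{xy}+D_{xy}+R_{xy}>0$. Every vertex is incident to at least one edge. For fixed $s\in\mathbb{C}$ with $\operatorname{Re}s>0$, the admittance of an edge $xy$ is $$\rho_{xy}=\frac{s}{L_{xy}s^2+R_{xy}s+D_{xy}},$$ and $\rho_{xy}=0$ if $xy$ is not an edge. Put $\rho(x)=\sum_{y\in V}\rho_{xy}$. The normalized complex-weighted Laplacian acts on functions $f:V\to\mathbb{C}$ by $$\widetilde\Delta_\rho f(x)=f(x)-\frac{1}{\rho(x)}\sum_{y\in V}f(y)\rho_{xy}.$$ (For $\operatorname{Re}s>0$ the denominators in $\rho_{xy}$ are nonzero and $\rho(x)\neq 0$, so this is well defined.) *)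

theory Defs
  imports Complex_Main
begin

text \<open>
  An edge \<open>xy\<close> is the two-element set \<open>{x, y}\<close>.  The parameters \<open>L\<close>, \<open>D\<close>, \<open>R\<close> are constrained
  only on edges; their values elsewhere are never used.
\<close>

locale electrical_network =
  fixes V :: "'a set"
    and E :: "'a set set"
    and L D R :: "'a \<Rightarrow> 'a \<Rightarrow> real"
  assumes finite_vertices: "finite V"
    and nonempty_vertices: "V \<noteq> {}"
    and edges: "E \<subseteq> {{x, y} | x y. x \<in> V \<and> y \<in> V \<and> x \<noteq> y}"
    and incident: "x \<in> V \<Longrightarrow> \<exists>e\<in>E. x \<in> e"
    and L_sym: "{x, y} \<in> E \<Longrightarrow> L x y = L y x"
    and D_sym: "{x, y} \<in> E \<Longrightarrow> D x y = D y x"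
    and R_sym: "{x, y} \<in> E \<Longrightarrow> R x y = R y x"
    and L_nonneg: "{x, y} \<in> E \<Longrightarrow> L x y \<ge> 0"
    and D_nonneg: "{x, y} \<in> E \<Longrightarrow> D x y \<ge> 0"
    and R_nonneg: "{x, y} \<in> E \<Longrightarrow> R x y \<ge> 0"
    and sum_pos: "{x, y} \<in> E \<Longrightarrow> L x y + D x y + R x y > 0"

definition admittance ::
  "'a set set \<Rightarrow> ('a \<Rightarrow> 'a \<Rightarrow> real) \<Rightarrow> ('a \<Rightarrow> 'a \<Rightarrow> real) \<Rightarrow> ('a \<Rightarrow> 'a \<Rightarrow> real)
    \<Rightarrow> complex \<Rightarrow> 'a \<Rightarrow> 'a \<Rightarrow> complex" where
  "admittance E L D R s x y =
    (if {x, y} \<in> E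
     then s / (of_real (L x y) * s\<^sup>2 + of_real (R x y) * s + of_real (D x y))
     else 0)"

definition normalized_laplacian ::
  "'a set \<Rightarrow> ('a \<Rightarrow> 'a \<Rightarrow> complex) \<Rightarrow> ('a \<Rightarrow> complex) \<Rightarrow> 'a \<Rightarrow> complex" where
  "normalized_laplacian V \<rho> f x =
    f x - 1 / (\<Sum>y\<in>V. \<rho> x y) * (\<Sum>y\<in>V. f y * \<rho> x y)"

text \<open>
  Eigenvalues of an operator on the space of functions \<open>V \<rightarrow> \<complex>\<close>.  Such a function is represented
  by a total function of which only the values on \<open>V\<close> matter, so both nonvanishing of the
  eigenfunction and the eigenvalue equation are required on \<open>V\<close>.  This presupposes that \<open>T f\<close> on
  \<open>V\<close> depends only on \<open>f\<close> on \<open>V\<close>, as is the case for \<open>normalized_laplacian V \<rho>\<close>.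
\<close>

definition is_eigenvalue_on ::
  "'a set \<Rightarrow> (('a \<Rightarrow> complex) \<Rightarrow> 'a \<Rightarrow> complex) \<Rightarrow> complex \<Rightarrow> bool" where
  "is_eigenvalue_on V T \<mu> \<longleftrightarrow>
    (\<exists>f. (\<exists>x\<in>V. f x \<noteq> 0) \<and> (\<forall>x\<in>V. T f x = \<mu> * f x))"

end

theory Submission
  imports Defs
begin

text \<open>
  The impedance \<open>1 / \<rho>\<^sub>x\<^sub>y = L s + R + D / s\<close> lies in the sector of numbers \<open>z\<close> with
  \<open>\<bar>z\<bar> Re s \<le> \<bar>s\<bar> Re z\<close>, which is a convex cone closed under conjugation, hence so does \<open>\<rho>\<^sub>x\<^sub>y\<close>.
  Pairing the eigenvalue equation with \<open>f\<close> in the weight \<open>\<rho>(x)\<close> gives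
  \<open>\<Sum> \<rho>\<^sub>x\<^sub>y f(y) cnj f(x) = (1 - \<mu>) \<Sum> \<rho>\<^sub>x\<^sub>y \<bar>f(x)\<bar>\<^sup>2\<close>.  By AM-GM and symmetry the left-hand side has
  modulus at most \<open>\<Sum> \<bar>\<rho>\<^sub>x\<^sub>y\<bar> \<bar>f(x)\<bar>\<^sup>2\<close>, and by the sector condition this is at most \<open>\<bar>s\<bar> / Re s\<close>
  times the real part of \<open>\<Sum> \<rho>\<^sub>x\<^sub>y \<bar>f(x)\<bar>\<^sup>2\<close>.
\<close>

lemma norm_weighted_form_le:
  fixes \<rho> :: "'a \<Rightarrow> 'a \<Rightarrow> complex" and f :: "'a \<Rightarrow> complex"
  assumes sym: "\<And>x y. x \<in> V \<Longrightarrow> y \<in> V \<Longrightarrow> \<rho> x y = \<rho> y x"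
  shows "cmod (\<Sum>x\<in>V. \<Sum>y\<in>V. \<rho> x y * f y * cnj (f x))
    \<le> (\<Sum>x\<in>V. \<Sum>y\<in>V. cmod (\<rho> x y) * (cmod (f x))\<^sup>2)"
proof -
  have amgm: "cmod (\<rho> x y * f y * cnj (f x))
      \<le> (cmod (\<rho> x y) * (cmod (f x))\<^sup>2 + cmod (\<rho> x y) * (cmod (f y))\<^sup>2) / 2" for x y
  proof -
    have "cmod (f y) * cmod (f x) \<le> ((cmod (f x))\<^sup>2 + (cmod (f y))\<^sup>2) / 2"
      using sum_squares_bound[of "cmod (f x)" "cmod (f y)"] by (simp add: mult_ac)
    then have "cmod (\<rho> x y) * (cmod (f y) * cmod (f x))
        \<le> cmod (\<rho> x y) * (((cmod (f x))\<^sup>2 + (cmod (f y))\<^sup>2) / 2)"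
      by (rule mult_left_mono) simp
    then show ?thesis
      by (simp add: norm_mult algebra_simps)
  qed
  \<comment> \<open>Exchanging the sums and using \<open>sym\<close> makes the two halves of the
    AM-GM bound equal.\<close>
  have swap: "(\<Sum>x\<in>V. \<Sum>y\<in>V. cmod (\<rho> x y) * (cmod (f y))\<^sup>2)
      = (\<Sum>x\<in>V. \<Sum>y\<in>V. cmod (\<rho> x y) * (cmod (f x))\<^sup>2)"
    by (subst sum.swap) (intro sum.cong refl, simp add: sym)
  have "cmod (\<Sum>x\<in>V. \<Sum>y\<in>V. \<rho> x y * f y * cnj (f x))
      \<le> (\<Sum>x\<in>V. \<Sum>y\<in>V.
          (cmod (\<rho> x y) * (cmod (f x))\<^sup>2 + cmod (\<rho> x y) * (cmod (f y))\<^sup>2) / 2)"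
    by (intro sum_norm_le amgm)
  also have "\<dots> = (\<Sum>x\<in>V. \<Sum>y\<in>V. cmod (\<rho> x y) * (cmod (f x))\<^sup>2)"
    by (simp add: sum_divide_distrib[symmetric] sum.distrib swap)
  finally show ?thesis .
qed

text \<open>Isolates the spectral argument from the network: of the weights it uses symmetry, a
  sector of opening governed by \<open>K\<close>, and total weights with positive real part.\<close>

lemma eigenvalue_sector_bound:
  fixes \<rho> :: "'a \<Rightarrow> 'a \<Rightarrow> complex" and K :: real
  assumes fin: "finite V"
    and sym: "\<And>x y. x \<in> V \<Longrightarrow> y \<in> V \<Longrightarrow> \<rho> x y = \<rho> y x"
    and sector: "\<And>x y. x \<in> V \<Longrightarrow> y \<in> V \<Longrightarrow> cmod (\<rho> x y) \<le> K * Re (\<rho> x y)"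
    and pos: "\<And>x. x \<in> V \<Longrightarrow> Re (\<Sum>y\<in>V. \<rho> x y) > 0"
    and eig: "is_eigenvalue_on V (normalized_laplacian V \<rho>) \<mu>"
  shows "cmod (1 - \<mu>) \<le> K"
proof -
  from eig obtain f z where z: "z \<in> V" "f z \<noteq> 0"
    and eq: "\<And>x. x \<in> V \<Longrightarrow> normalized_laplacian V \<rho> f x = \<mu> * f x"
    unfolding is_eigenvalue_on_def by blast
  define w where "w x = (\<Sum>y\<in>V. \<rho> x y)" for x
  \<comment> \<open>The squared norm of \<open>f\<close> in the complex weight \<open>w\<close>; it
    is a complex number, and its real part will serve as the positive quantity to cancel.\<close>
  define N where "N = (\<Sum>x\<in>V. w x * (cmod (f x))\<^sup>2)"
  have w_pos: "Re (w x) > 0" if "x \<in> V" for x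
    using pos[OF that] by (simp add: w_def)
  have eq': "(\<Sum>y\<in>V. \<rho> x y * f y) = (1 - \<mu>) * f x * w x" if "x \<in> V" for x
  proof -
    have "w x \<noteq> 0"
      using w_pos[OF that] by auto
    with eq[OF that] show ?thesis
      by (simp add: normalized_laplacian_def w_def[symmetric] field_simps)
  qed
  have Re_N: "Re N = (\<Sum>x\<in>V. Re (w x) * (cmod (f x))\<^sup>2)"
    by (simp add: N_def flip: of_real_power)
  have N_pos: "Re N > 0"
    unfolding Re_N
    by (rule sum_pos2[OF fin z(1)]) (use z w_pos in \<open>auto intro!: mult_nonneg_nonneg less_imp_le[OF w_pos]\<close>)
  have "(\<Sum>x\<in>V. \<Sum>y\<in>V. \<rho> x y * f y * cnj (f x)) = (\<Sum>x\<in>V. (1 - \<mu>) * f x * w x * cnj (f x))"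
    by (simp add: sum_distrib_right[symmetric] eq')
  also have "\<dots> = (1 - \<mu>) * N"
    unfolding N_def sum_distrib_left
    by (intro sum.cong refl) (simp add: complex_norm_square mult_ac flip: of_real_power)
  finally have "cmod (1 - \<mu>) * cmod N
      \<le> (\<Sum>x\<in>V. \<Sum>y\<in>V. cmod (\<rho> x y) * (cmod (f x))\<^sup>2)"
    using norm_weighted_form_le[of V \<rho> f, OF sym] by (simp add: norm_mult)
  also have "\<dots> \<le> (\<Sum>x\<in>V. \<Sum>y\<in>V. K * Re (\<rho> x y) * (cmod (f x))\<^sup>2)"
    by (intro sum_mono mult_right_mono sector) auto
  also have "\<dots> = K * Re N"
    by (simp add: Re_N w_def Re_sum sum_distrib_left sum_distrib_right mult.assoc)
  finally have *: "cmod (1 - \<mu>) * cmod N \<le> K * Re N" .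
  \<comment> \<open>Passing from \<open>cmod N\<close> down to \<open>Re N\<close> leaves the same
    positive factor on both sides.\<close>
  have "cmod (1 - \<mu>) * Re N \<le> cmod (1 - \<mu>) * cmod N"
    by (intro mult_left_mono complex_Re_le_cmod) simp
  with * N_pos show ?thesis
    by (smt (verit) mult_le_cancel_right)
qed

lemma inverse_impedance_sector:
  fixes s :: complex and l d r :: real
  assumes s: "Re s > 0" and nonneg: "l \<ge> 0" "d \<ge> 0" "r \<ge> 0" and sum: "l + d + r > 0"
  defines "\<rho> \<equiv> s / (of_real l * s\<^sup>2 + of_real r * s + of_real d)"
  shows "Re \<rho> > 0" "cmod \<rho> \<le> cmod s / Re s * Re \<rho>"
proof -
  define z where "z = of_real l * s + of_real r + of_real d * inverse s"
  define n where "n = cmod s"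
  have s0: "s \<noteq> 0" using s by auto
  have n: "n > 0" "Re s \<le> n" by (simp_all add: n_def s0 complex_Re_le_cmod)
  have "of_real l * s\<^sup>2 + of_real r * s + of_real d = s * z"
    using s0 by (simp add: z_def field_simps power2_eq_square)
  then have \<rho>: "\<rho> = inverse z"
    using s0 by (simp add: \<rho>_def divide_inverse)
  have Re_z: "Re z = l * Re s + r + d * (Re s / n\<^sup>2)"
    by (simp add: z_def n_def cmod_power2)
  have "0 < Re z"
  proof -
    \<comment> \<open>All coefficients of \<open>l\<close>, \<open>r\<close>, \<open>d\<close> in
      \<open>Re z\<close> are positive, and \<open>sum\<close> forces one of the three parameters to
      be positive.\<close>
    have "0 < Re s / n\<^sup>2" using s n by simp
    then show ?thesis
      unfolding Re_z using nonneg sum s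
      by (smt (verit) mult_nonneg_nonneg mult_pos_pos)
  qed
  then have z0: "cmod z > 0" by auto
  have Re_\<rho>: "Re \<rho> = Re z / (cmod z)\<^sup>2"
    by (simp add: \<rho> cmod_power2)
  show "Re \<rho> > 0"
    unfolding Re_\<rho> using \<open>0 < Re z\<close> z0 by simp
  have "cmod z \<le> l * n + r + d / n"
    unfolding z_def n_def
    by (intro norm_triangle_mono) (use nonneg in \<open>simp_all add: norm_mult norm_inverse divide_inverse\<close>)
  then have "cmod z * Re s \<le> (l * n + r + d / n) * Re s"
    using s by (intro mult_right_mono) auto
  \<comment> \<open>The \<open>l\<close> and \<open>d\<close> terms agree on both sides; only the
    \<open>r\<close> term uses \<open>Re s \<le> n\<close>.\<close>
  also have "\<dots> \<le> n * Re z"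
    unfolding Re_z using n nonneg mult_left_mono[OF n(2) nonneg(3)]
    by (simp add: field_simps power2_eq_square)
  finally have "cmod z * Re s \<le> n * Re z" .
  then show "cmod \<rho> \<le> cmod s / Re s * Re \<rho>"
    unfolding Re_\<rho> unfolding \<rho> norm_inverse n_def using z0 s
    by (simp add: field_simps power2_eq_square del: zero_less_norm_iff)
qed

context electrical_network
begin

lemma admittance_sym: "admittance E L D R s x y = admittance E L D R s y x"
  using L_sym[of x y] D_sym[of x y] R_sym[of x y]
  by (simp add: admittance_def insert_commute)

text \<open>On edges this is the sector bound for inverse impedances; elsewhere the default value 0
  makes both sides vanish.\<close>

lemma admittance_sector:
  assumes "Re s > 0"
  shows "cmod (admittance E L D R s x y) \<le> cmod s / Re s * Re (admittance E L D R s x y)"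
  using inverse_impedance_sector(2)[OF assms L_nonneg D_nonneg R_nonneg sum_pos]
  by (simp add: admittance_def)

lemma Re_admittance_pos:
  assumes "Re s > 0" "{x, y} \<in> E"
  shows "Re (admittance E L D R s x y) > 0"
  using inverse_impedance_sector(1)[OF assms(1) L_nonneg D_nonneg R_nonneg sum_pos] assms(2)
  by (simp add: admittance_def)

lemma Re_total_admittance_pos:
  assumes s: "Re s > 0" and x: "x \<in> V"
  shows "Re (\<Sum>y\<in>V. admittance E L D R s x y) > 0"
proof -
  \<comment> \<open>An edge at \<open>x\<close> supplies one strictly positive term; the remaining
    terms are nonnegative.\<close>
  obtain y where y: "y \<in> V" "{x, y} \<in> E"
    using incident[OF x] edges by (fastforce simp: insert_commute)
  have "Re (admittance E L D R s x u) \<ge> 0" for u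
  proof (cases "{x, u} \<in> E")
    case True
    then show ?thesis
      using Re_admittance_pos[OF s] less_imp_le by blast
  qed (simp add: admittance_def)
  then show ?thesis
    unfolding Re_sum
    by (intro sum_pos2[OF finite_vertices y(1)] Re_admittance_pos[OF s y(2)])
qed

end

theorem theorem1:
  fixes V :: "'a set" and E :: "'a set set"
    and L D R :: "'a \<Rightarrow> 'a \<Rightarrow> real"
    and s \<mu> :: complex
  assumes "electrical_network V E L D R"
    and "Re s > 0"
    and "is_eigenvalue_on V (normalized_laplacian V (admittance E L D R s)) \<mu>"
  shows "cmod (1 - \<mu>) \<le> cmod s / Re s"
proof -
  interpret electrical_network V E L D R by fact
  show ?thesis
    using eigenvalue_sector_bound[OF finite_vertices admittance_sym
        admittance_sector[OF assms(2)] Re_total_admittance_pos[OF assms(2)] assms(3)] .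
qed

end
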